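(* Let $k\ge1$, $g\ge1$, $n\ge 1$, $r\ge1$ be integers, $p\in(0,1)$, $q=1-p$. Then $$ \begin{aligned} M(k,g,n,r)&=\frac1q\bigl[X(k,1,n+1-(r-1)(g-1),r)-X(k,1,n+1-r(g-1),r)\bigr]\\ &\quad+M(k,1,n-r(g-1),r)\\ &\quad+Y(k,n-(r-1)(g-1),r)-Y(k,n-r(g-1),r). \end{aligned} $$
   Context: Consider independent trials, each $S$ (success) with probability $p$ or $F$ (failure) with probability $q=1-p$. The success runs (of order $k$ with gap $g$) are defined inductively. The first success run (if it exists) is the first run of at least $k$ consecutive successes, taken maximal. A success run terminates at its last success trial $m$ (so either $m$ is the last trial or trial $m+1$ is a failure). If the $j$-th success run terminates at trial $m$, then the $(j+1)$-th success run (if it exists) is the first run of at least $k$ consecutive successes which begins later than trial $m+g$, taken maximal among runs beginning later than trial $m+g$ (trials $m+1,\dots,m+g$ form the gap). Notation: $M(k,g,n,r)$ is the probability that a sequence of $n$ trials contains exactly $r$ success runs (of order $k$ with gap $g$). $X(k,g,n,r)$ is the probability that there is an $r$-th success run, that it terminates at trial $n-1$, and that trial $n$ is an $F$. $Y(k,n,r)=\sum_{m=1}^{n}X(k,1,m,r)$. For $r\ge 1$, $M(k,g,n,r)$, $X(k,g,n,r)$ and $Y(k,n,r)$ are taken to be $0$ when $n\le 0$. *)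

theory Defs
  imports "HOL-Probability.Probability"
begin

text \<open>
  A sequence of trials is a list of Booleans, \<^const>\<open>True\<close> standing for a success.
  Trials are numbered from 1, so trial \<open>i\<close> of \<open>xs\<close> is \<open>xs ! (i - 1)\<close>.
  A run is given by the numbers \<open>a\<close>, \<open>b\<close> of its first and its last trial.
\<close>

definition successes :: "bool list \<Rightarrow> nat \<Rightarrow> nat \<Rightarrow> bool" where
  "successes xs a b \<longleftrightarrow>
     1 \<le> a \<and> a \<le> b \<and> b \<le> length xs \<and> (\<forall>i\<in>{a..b}. xs ! (i - 1))"

text \<open>
  Runs of at least \<open>k\<close> successes that begin later than trial \<open>t\<close> and are maximal among the
  runs beginning later than \<open>t\<close>. Such a run may begin at trial \<open>t + 1\<close> even if trial \<open>t\<close> is a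
  success.
\<close>

definition run_after :: "nat \<Rightarrow> bool list \<Rightarrow> nat \<Rightarrow> nat \<Rightarrow> nat \<Rightarrow> bool" where
  "run_after k xs t a b \<longleftrightarrow>
     t < a \<and> successes xs a b \<and> k \<le> card {a..b} \<and>
     (\<forall>a' b'. t < a' \<and> successes xs a' b' \<and> {a..b} \<subseteq> {a'..b'} \<longrightarrow> a' = a \<and> b' = b)"

definition first_run_after :: "nat \<Rightarrow> bool list \<Rightarrow> nat \<Rightarrow> nat \<Rightarrow> nat \<Rightarrow> bool" where
  "first_run_after k xs t a b \<longleftrightarrow>
     run_after k xs t a b \<and> (\<forall>a' b'. run_after k xs t a' b' \<longrightarrow> a \<le> a')"

text \<open>
  \<open>success_run k g xs j a m\<close>: the \<open>j\<close>-th success run (of order \<open>k\<close> with gap \<open>g\<close>) exists, begins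
  at trial \<open>a\<close> and terminates at trial \<open>m\<close>.
\<close>

inductive success_run :: "nat \<Rightarrow> nat \<Rightarrow> bool list \<Rightarrow> nat \<Rightarrow> nat \<Rightarrow> nat \<Rightarrow> bool"
  for k g :: nat and xs :: "bool list" where
  first: "first_run_after k xs 0 a m \<Longrightarrow> success_run k g xs 1 a m"
| next_run: "success_run k g xs j a m \<Longrightarrow> first_run_after k xs (m + g) a' m' \<Longrightarrow>
     success_run k g xs (Suc j) a' m'"

definition num_success_runs :: "nat \<Rightarrow> nat \<Rightarrow> bool list \<Rightarrow> nat" where
  "num_success_runs k g xs = card {(a, m). \<exists>j. success_run k g xs j a m}"

definition trials :: "real \<Rightarrow> nat \<Rightarrow> bool list pmf" where
  "trials p n = replicate_pmf n (bernoulli_pmf p)"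

text \<open>
  The numbers of trials are integers because the functions below are also used at nonpositive
  arguments, where they vanish by convention (for \<open>r \<ge> 1\<close>).
\<close>

definition M :: "real \<Rightarrow> nat \<Rightarrow> nat \<Rightarrow> int \<Rightarrow> nat \<Rightarrow> real" where
  "M p k g n r =
     (if n \<le> 0 \<and> 1 \<le> r then 0
      else measure_pmf.prob (trials p (nat n)) {xs. num_success_runs k g xs = r})"

definition X :: "real \<Rightarrow> nat \<Rightarrow> nat \<Rightarrow> int \<Rightarrow> nat \<Rightarrow> real" where
  "X p k g n r =
     (if n \<le> 0 then 0
      else measure_pmf.prob (trials p (nat n))
        {xs. (\<exists>a m. success_run k g xs r a m \<and> int m = n - 1) \<and> \<not> xs ! (nat n - 1)})"

definition Y :: "real \<Rightarrow> nat \<Rightarrow> int \<Rightarrow> nat \<Rightarrow> real" where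
  "Y p k n r = (\<Sum>m\<in>{1..n}. X p k 1 m r)"

end

theory Submission
  imports Defs
begin

text \<open>
  A run that terminates before the last trial is followed by a failure, which is the first trial
  of its gap; the other \<open>g - 1\<close> trials of the gap are unconstrained, and the search for the next
  run then starts afresh. Hence \<open>X(k, g, n, r + 1)\<close> is the convolution of \<open>X(k, g, \<cdot>, r)\<close> with
  \<open>X(k, 1, \<cdot>, 1)\<close>, delayed by \<open>g - 1\<close>, and by induction
  \<open>X(k, g, n, r) = X(k, 1, n - (r - 1) (g - 1), r)\<close>.
  Splitting by the trial at which the \<open>r\<close>-th run terminates, the probability that this run exists
  is \<open>X(k, g, 1, r) + \<dots> + X(k, g, n, r) + X(k, g, n + 1, r) / q\<close>, and \<open>M(k, g, n, r)\<close> is the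
  difference of these probabilities for \<open>r\<close> and \<open>r + 1\<close>. The terms for \<open>r + 1\<close> are the same
  in \<open>M(k, g, n, r)\<close> and in \<open>M(k, 1, n - r (g - 1), r)\<close>.
\<close>

section \<open>Maximal runs through their neighbouring trials\<close>

lemma successes_extend_left:
  assumes "successes xs a b" "Suc c = a" "1 \<le> c" "xs ! (c - 1)"
  shows "successes xs c b"
proof -
  have "xs ! (i - 1)" if "i \<in> {c..b}" for i
    using assms that by (cases "i = c") (auto simp: successes_def)
  then show ?thesis
    using assms by (auto simp: successes_def)
qed

lemma successes_extend_right:
  assumes "successes xs a b" "b < length xs" "xs ! b"
  shows "successes xs a (Suc b)"
proof -
  have "xs ! (i - 1)" if "i \<in> {a..Suc b}" for i
    using assms that by (cases "i = Suc b") (auto simp: successes_def)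
  then show ?thesis
    using assms by (auto simp: successes_def)
qed

text \<open>Maximality is local: a strictly larger run contains trial \<open>a - 1\<close> or trial
  \<open>b + 1\<close>, which sit at the indices \<open>a - 2\<close> and \<open>b\<close>. For
  \<open>a = Suc t\<close> there is no left neighbour to test, since no competing run may begin at
  \<open>t\<close>.\<close>

lemma run_after_iff:
  "run_after k xs t a b \<longleftrightarrow>
     t < a \<and> successes xs a b \<and> k \<le> Suc b - a \<and>
     (a = Suc t \<or> \<not> xs ! (a - 2)) \<and> (b = length xs \<or> \<not> xs ! b)"
    (is "?L \<longleftrightarrow> ?R")
proof
  assume L: ?L
  then have ta: "t < a" and s: "successes xs a b" and k: "k \<le> Suc b - a"
    and max: "\<And>a' b'. t < a' \<Longrightarrow> successes xs a' b' \<Longrightarrow> {a..b} \<subseteq> {a'..b'} \<Longrightarrow> a' = a \<and> b' = b"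
    by (auto simp: run_after_def)
  have "\<not> xs ! (a - 2)" if "a \<noteq> Suc t"
  proof
    assume "xs ! (a - 2)"
    then have "successes xs (a - 1) b"
      using that ta by (intro successes_extend_left[OF s]) (auto simp: numeral_2_eq_2)
    then show False
      using max[of "a - 1" b] that ta by fastforce
  qed
  moreover have "\<not> xs ! b" if "b \<noteq> length xs"
  proof
    assume "xs ! b"
    then have "successes xs a (Suc b)"
      using that s by (intro successes_extend_right[OF s]) (auto simp: successes_def)
    then show False
      using max[of a "Suc b"] ta by auto
  qed
  ultimately show ?R
    using ta s k by blast
next
  assume R: ?R
  have "a' = a \<and> b' = b"
    if "t < a'" "successes xs a' b'" "{a..b} \<subseteq> {a'..b'}" for a' b'
  proof -
    have le: "a' \<le> a" "b \<le> b'"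
      using R that by (auto simp: successes_def)
    have "a' = a"
    proof (rule ccontr)
      assume "a' \<noteq> a"
      then have "a - 1 \<in> {a'..b'}" "a \<noteq> Suc t"
        using le R that by (auto simp: successes_def)
      then have "xs ! (a - 1 - 1)"
        using that(2) unfolding successes_def by blast
      then show False
        using R \<open>a \<noteq> Suc t\<close> by (simp add: numeral_2_eq_2)
    qed
    moreover have "b' = b"
    proof (rule ccontr)
      assume "b' \<noteq> b"
      then have "Suc b \<in> {a'..b'}" "b \<noteq> length xs"
        using le R that by (auto simp: successes_def)
      then have "xs ! (Suc b - 1)"
        using that(2) unfolding successes_def by blast
      then show False
        using R \<open>b \<noteq> length xs\<close> by simp
    qed
    ultimately show ?thesis ..
  qed
  then show ?L
    using R unfolding run_after_def by auto
qed

lemma run_after_bounds: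
  "run_after k xs t a b \<Longrightarrow> t < a \<and> a \<le> b \<and> b \<le> length xs"
  by (auto simp: run_after_def successes_def)

lemma run_after_end_unique:
  assumes "run_after k xs t a b" "run_after k xs t a b'"
  shows "b = b'"
proof (rule ccontr)
  assume "b \<noteq> b'"
  then consider "b < b'" | "b' < b" by linarith
  then show False
    using assms unfolding run_after_def
    by cases (metis atLeastatMost_subset_iff less_or_eq_imp_le less_irrefl order_refl)+
qed

lemma first_run_after_unique:
  "first_run_after k xs t a b \<Longrightarrow> first_run_after k xs t a' b' \<Longrightarrow> a = a' \<and> b = b'"
  unfolding first_run_after_def by (metis run_after_end_unique order_antisym)

section \<open>Cutting a sequence at a failure and restarting it after a prefix\<close>

lemma run_after_append_False:
  "run_after k (ys @ False # zs) t a b \<and> b \<le> length ys \<longleftrightarrow> run_after k ys t a b"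
proof -
  have "successes (ys @ False # zs) a b \<longleftrightarrow> successes ys a b" if "b \<le> length ys"
    using that by (auto simp: successes_def nth_append)
  moreover have "b \<le> length ys" if "successes ys a b"
    using that by (simp add: successes_def)
  moreover have "(ys @ False # zs) ! (a - 2) = ys ! (a - 2)" if "successes ys a b"
    using that by (auto simp: successes_def nth_append)
  moreover have "(b = length (ys @ False # zs) \<or> \<not> (ys @ False # zs) ! b) \<longleftrightarrow>
      b = length ys \<or> \<not> ys ! b" if "b \<le> length ys"
    using that by (auto simp: nth_append)
  ultimately show ?thesis
    unfolding run_after_iff by blast
qed

lemma first_run_after_append_False:
  "first_run_after k (ys @ False # zs) t a b \<and> b \<le> length ys \<longleftrightarrow> first_run_after k ys t a b"
proof -
  have "a \<le> a'"
    if r: "run_after k ys t a b" and r': "run_after k (ys @ False # zs) t a' b'"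
      and min: "\<And>a' b'. run_after k ys t a' b' \<Longrightarrow> a \<le> a'" for a' b'
  proof (cases "b' \<le> length ys")
    case True
    then show ?thesis
      using min r' run_after_append_False by blast
  next
    case False
    \<comment> \<open>A run ending beyond \<open>ys\<close> cannot contain the failure at trial
      \<open>Suc (length ys)\<close>, so it begins after that trial and cannot precede a run inside
      \<open>ys\<close>.\<close>
    have "\<not> a' \<le> Suc (length ys)"
    proof
      assume "a' \<le> Suc (length ys)"
      then have "Suc (length ys) \<in> {a'..b'}"
        using False by simp
      then have "(ys @ False # zs) ! (Suc (length ys) - 1)"
        using r' unfolding run_after_def successes_def by blast
      then show False by simp
    qed
    then show ?thesis
      using run_after_bounds[OF r] by simp
  qed
  then show ?thesis
    unfolding first_run_after_def using run_after_append_False by blast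
qed

lemma successes_drop:
  assumes "s \<le> length xs"
  shows "successes (drop s xs) a b \<longleftrightarrow> 1 \<le> a \<and> successes xs (s + a) (s + b)"
proof -
  have eq: "{s + a..s + b} = (+) s ` {a..b}" by simp
  have "(\<forall>i\<in>{s + a..s + b}. xs ! (i - 1)) \<longleftrightarrow> (\<forall>i\<in>{a..b}. xs ! (s + i - 1))"
    unfolding eq by blast
  moreover have "drop s xs ! (i - 1) = xs ! (s + i - 1)" if "1 \<le> i" for i
    using that assms by simp
  ultimately show ?thesis
    using assms unfolding successes_def by auto
qed

text \<open>The left neighbour of a run is tested only if \<open>a\<close> exceeds
  \<open>Suc t\<close>, and then it lies after trial \<open>s + t\<close>; hence the first
  \<open>s\<close> trials do not influence the search. This makes the search start afresh behind a
  gap.\<close>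

lemma run_after_drop:
  assumes "s \<le> length xs"
  shows "run_after k (drop s xs) t a b \<longleftrightarrow> run_after k xs (s + t) (s + a) (s + b)"
proof -
  have "drop s xs ! (a - 2) = xs ! (s + a - 2)" if "a \<noteq> Suc t" "t < a"
    using that assms by simp
  moreover have "drop s xs ! b = xs ! (s + b)"
    using assms by simp
  moreover have "s + a = Suc (s + t) \<longleftrightarrow> a = Suc t" "b = length (drop s xs) \<longleftrightarrow> s + b = length xs"
    using assms by auto
  ultimately show ?thesis
    unfolding run_after_iff successes_drop[OF assms] by auto
qed

lemma first_run_after_drop:
  assumes "s \<le> length xs"
  shows "first_run_after k (drop s xs) t a b \<longleftrightarrow>
    first_run_after k xs (s + t) (s + a) (s + b)"
proof -
  have "(\<forall>a' b'. run_after k (drop s xs) t a' b' \<longrightarrow> a \<le> a') \<longleftrightarrow>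
    (\<forall>a' b'. run_after k xs (s + t) a' b' \<longrightarrow> s + a \<le> a')" (is "?L = ?R")
  proof
    assume L: ?L
    show ?R
    proof (intro allI impI)
      fix a' b' assume r: "run_after k xs (s + t) a' b'"
      then have "s \<le> a'" "s \<le> b'"
        using run_after_bounds[OF r] by auto
      then show "s + a \<le> a'"
        using L r run_after_drop[OF assms, of k t "a' - s" "b' - s"] by fastforce
    qed
  next
    assume ?R
    then show ?L
      using run_after_drop[OF assms] by (meson add_le_cancel_left)
  qed
  then show ?thesis
    unfolding first_run_after_def run_after_drop[OF assms] by blast
qed

section \<open>The sequence of success runs\<close>

lemma success_run_pos: "success_run k g xs j a m \<Longrightarrow> 0 < j"
  by (induction rule: success_run.induct) auto

lemma success_run_1_iff: "success_run k g xs (Suc 0) a m \<longleftrightarrow> first_run_after k xs 0 a m"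
proof
  assume "success_run k g xs (Suc 0) a m"
  then show "first_run_after k xs 0 a m"
    by cases (auto dest: success_run_pos)
qed (simp add: success_run.first[simplified])

lemma success_run_Suc_iff:
  assumes "0 < j"
  shows "success_run k g xs (Suc j) a m \<longleftrightarrow>
    (\<exists>a' m'. success_run k g xs j a' m' \<and> first_run_after k xs (m' + g) a m)"
proof
  assume "success_run k g xs (Suc j) a m"
  then show "\<exists>a' m'. success_run k g xs j a' m' \<and> first_run_after k xs (m' + g) a m"
    by cases (use assms in auto)
qed (auto intro: success_run.next_run)

lemma success_run_run_after:
  assumes "success_run k g xs j a m"
  obtains t where "run_after k xs t a m"
  using assms by cases (auto simp: first_run_after_def)

lemma success_run_bounds:
  assumes "success_run k g xs j a m"
  shows "0 < a \<and> a \<le> m \<and> m \<le> length xs"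
proof -
  obtain t where "run_after k xs t a m"
    using assms by (rule success_run_run_after)
  then show ?thesis
    using run_after_bounds[of k xs t a m] by auto
qed

lemma success_run_end:
  assumes "success_run k g xs j a m" "m < length xs"
  shows "\<not> xs ! m"
proof -
  obtain t where "run_after k xs t a m"
    using assms(1) by (rule success_run_run_after)
  then show ?thesis
    using assms(2) by (simp add: run_after_iff)
qed

lemma success_run_unique:
  "success_run k g xs j a m \<Longrightarrow> success_run k g xs j a' m' \<Longrightarrow> a = a' \<and> m = m'"
proof (induction j arbitrary: a m a' m')
  case 0
  then show ?case by (auto dest: success_run_pos)
next
  case (Suc j)
  show ?case
  proof (cases "j = 0")
    case True
    then show ?thesis
      using Suc.prems first_run_after_unique by (auto simp: success_run_1_iff)
  next
    case False
    then obtain b l b' l' where "success_run k g xs j b l" "first_run_after k xs (l + g) a m"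
      "success_run k g xs j b' l'" "first_run_after k xs (l' + g) a' m'"
      using Suc.prems by (auto simp: success_run_Suc_iff)
    then show ?thesis
      using Suc.IH first_run_after_unique by blast
  qed
qed

text \<open>A run reaching the end of \<open>ys\<close> stays maximal because a failure follows, and
  runs beyond that failure come later in the numbering.\<close>

lemma success_run_append_False:
  "success_run k g (ys @ False # zs) j a m \<and> m \<le> length ys \<longleftrightarrow> success_run k g ys j a m"
proof (induction j arbitrary: a m)
  case 0
  then show ?case by (auto dest: success_run_pos)
next
  case (Suc j)
  show ?case
  proof (cases "j = 0")
    case True
    then show ?thesis
      by (simp add: success_run_1_iff first_run_after_append_False)
  next
    case False
    \<comment> \<open>The preceding run ends before \<open>m\<close>, so it obeys the same bound and
      the induction hypothesis applies to it.\<close>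
    have "m' \<le> length ys" if "first_run_after k xs (m' + g) a m" "m \<le> length ys" for m' xs
      using that run_after_bounds[of k xs "m' + g" a m] by (simp add: first_run_after_def)
    then have "success_run k g (ys @ False # zs) (Suc j) a m \<and> m \<le> length ys \<longleftrightarrow>
      (\<exists>a' m'. (success_run k g (ys @ False # zs) j a' m' \<and> m' \<le> length ys) \<and>
        (first_run_after k (ys @ False # zs) (m' + g) a m \<and> m \<le> length ys))"
      using False by (simp only: success_run_Suc_iff) blast
    then show ?thesis
      using False unfolding Suc.IH first_run_after_append_False by (simp add: success_run_Suc_iff)
  qed
qed

section \<open>Termination trials and the recursion between consecutive runs\<close>

definition run_ends_at :: "nat \<Rightarrow> nat \<Rightarrow> bool list \<Rightarrow> nat \<Rightarrow> nat \<Rightarrow> bool" where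
  "run_ends_at k g xs j m \<longleftrightarrow> (\<exists>a. success_run k g xs j a m)"

lemma run_ends_at_unique: "run_ends_at k g xs j m \<Longrightarrow> run_ends_at k g xs j m' \<Longrightarrow> m = m'"
  unfolding run_ends_at_def using success_run_unique by blast

lemma run_ends_at_bounds: "run_ends_at k g xs j m \<Longrightarrow> 0 < m \<and> m \<le> length xs"
  unfolding run_ends_at_def using success_run_bounds by fastforce

text \<open>Maximality forces trial \<open>m + 1\<close> to fail, and after this failure the later
  trials cannot change the run. The conditions thus concern disjoint blocks of trials, which lets
  independence enter.\<close>

lemma run_ends_at_take:
  assumes "m < length xs"
  shows "run_ends_at k g xs j m \<longleftrightarrow> run_ends_at k g (take m xs) j m \<and> \<not> xs ! m"
proof (cases "xs ! m")
  case True
  then show ?thesis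
    using success_run_end assms unfolding run_ends_at_def by blast
next
  case False
  then have "xs = take m xs @ False # drop (Suc m) xs"
    using id_take_nth_drop[OF assms] by simp
  then show ?thesis
    unfolding run_ends_at_def
    using False assms success_run_append_False[of k g "take m xs" "drop (Suc m) xs" j _ m]
    by simp
qed

text \<open>The trials behind \<open>t\<close> form a sequence of their own. Every gap gives the
  same first run; gap 1 matches the second factor of the renewal equation.\<close>

lemma ex_first_run_after_iff:
  "(\<exists>a. first_run_after k xs t a n) \<longleftrightarrow> t \<le> n \<and> run_ends_at k 1 (drop t xs) 1 (n - t)"
  (is "?L \<longleftrightarrow> ?R")
proof
  assume ?L
  then obtain a where a: "first_run_after k xs t a n" by blast
  then have b: "t < a" "a \<le> n" "n \<le> length xs"
    using run_after_bounds[of k xs t a n] by (auto simp: first_run_after_def)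
  then have "first_run_after k (drop t xs) 0 (a - t) (n - t)"
    using first_run_after_drop[of t xs k 0 "a - t" "n - t"] a by simp
  then show ?R
    using b by (auto simp: run_ends_at_def success_run_1_iff)
next
  assume R: ?R
  then obtain a where a: "first_run_after k (drop t xs) 0 a (n - t)"
    by (auto simp: run_ends_at_def success_run_1_iff)
  have "0 < n - t" "n - t \<le> length (drop t xs)"
    using R run_ends_at_bounds by blast+
  then have "t \<le> length xs" by simp
  then have "first_run_after k xs (t + 0) (t + a) (t + (n - t))"
    using a by (simp only: first_run_after_drop)
  then show ?L
    using R by auto
qed

lemma run_ends_at_Suc_iff:
  assumes "0 < j"
  shows "run_ends_at k g xs (Suc j) n \<longleftrightarrow>
    (\<exists>m. run_ends_at k g xs j m \<and> m + g \<le> n \<and> run_ends_at k 1 (drop (m + g) xs) 1 (n - (m + g)))"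
proof -
  have "run_ends_at k g xs (Suc j) n \<longleftrightarrow>
      (\<exists>m. run_ends_at k g xs j m \<and> (\<exists>a. first_run_after k xs (m + g) a n))"
    unfolding run_ends_at_def success_run_Suc_iff[OF assms] by blast
  then show ?thesis
    unfolding ex_first_run_after_iff .
qed

section \<open>Counting the success runs\<close>

lemma success_run_strict_mono:
  assumes "success_run k g xs j a m" "success_run k g xs j' a' m'" "j < j'"
  shows "m < m'"
  using assms(2,3)
proof (induction rule: success_run.induct)
  case (first a' m')
  then show ?case
    using success_run_pos[OF assms(1)] by simp
next
  case (next_run j' b l a' m')
  have "l < m'"
    using next_run.hyps(2) run_after_bounds[of k xs "l + g" a' m']
    by (simp add: first_run_after_def)
  moreover have "m \<le> l"
  proof (cases "j = j'")
    case True
    then show ?thesis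
      using success_run_unique[OF assms(1)] next_run.hyps(1) by blast
  next
    case False
    then show ?thesis
      using next_run by simp
  qed
  ultimately show ?case by simp
qed

text \<open>Every run ends later than its predecessor. The bound makes the set of indices
  finite.\<close>

lemma success_run_index_le: "success_run k g xs j a m \<Longrightarrow> j \<le> m"
proof (induction rule: success_run.induct)
  case (first a m)
  then show ?case
    using run_after_bounds[of k xs 0 a m] by (simp add: first_run_after_def)
next
  case (next_run j b l a m)
  then show ?case
    using run_after_bounds[of k xs "l + g" a m] by (simp add: first_run_after_def)
qed

text \<open>The indices correspond bijectively to the runs, and since every run beyond the first has
  a predecessor, they form an initial segment \<open>{1..N}\<close>.\<close>

lemma num_success_runs_eq_iff:
  assumes "0 < r"
  shows "num_success_runs k g xs = r \<longleftrightarrow>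
    (\<exists>m. run_ends_at k g xs r m) \<and> \<not> (\<exists>m. run_ends_at k g xs (Suc r) m)"
proof -
  define J where "J = {j. \<exists>m. run_ends_at k g xs j m}"
  have "\<forall>j\<in>J. \<exists>r. success_run k g xs j (fst r) (snd r)"
    by (auto simp: J_def run_ends_at_def)
  then obtain f where f: "\<And>j. j \<in> J \<Longrightarrow> success_run k g xs j (fst (f j)) (snd (f j))"
    by metis
  have "inj_on f J"
  proof (rule linorder_inj_onI)
    fix i j assume "i < j" "i \<in> J" "j \<in> J"
    then show "f i \<noteq> f j"
      using success_run_strict_mono[OF f f] by fastforce
  qed auto
  moreover have "{(a, m). \<exists>j. success_run k g xs j a m} = f ` J"
  proof (intro equalityI subsetI)
    fix x assume "x \<in> {(a, m). \<exists>j. success_run k g xs j a m}"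
    then obtain j where j: "success_run k g xs j (fst x) (snd x)" by auto
    then have "j \<in> J" by (auto simp: J_def run_ends_at_def)
    then show "x \<in> f ` J"
      using success_run_unique[OF j f] by (auto simp: prod_eq_iff)
  next
    fix x assume "x \<in> f ` J"
    then show "x \<in> {(a, m). \<exists>j. success_run k g xs j a m}"
      using f by fastforce
  qed
  ultimately have card: "num_success_runs k g xs = card J"
    by (simp add: num_success_runs_def card_image)
  have J_bounds: "J \<subseteq> {1..length xs}"
  proof
    fix j assume "j \<in> J"
    from f[OF this] show "j \<in> {1..length xs}"
      using success_run_index_le success_run_bounds success_run_pos
      by (metis One_nat_def Suc_leI atLeastAtMost_iff order_trans)
  qed
  then have fin: "finite J"
    using finite_subset by blast
  \<comment> \<open>Inserting 0 keeps the maximum meaningful when there is no run.\<close>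
  define N where "N = Max (insert 0 J)"
  have down: "j \<in> J" if "Suc j \<in> J" "0 < j" for j
    using that by (auto simp: J_def run_ends_at_def success_run_Suc_iff)
  have "J = {1..N}"
  proof (intro equalityI subsetI)
    fix j assume "j \<in> J"
    then show "j \<in> {1..N}"
      using J_bounds fin by (auto simp: N_def)
  next
    fix j assume j: "j \<in> {1..N}"
    then have "N \<in> J"
      using Max_in[of "insert 0 J"] fin by (auto simp: N_def)
    have "j \<le> N" using j by simp
    \<comment> \<open>The guard is carried through the downward induction from \<open>N\<close>
      because \<open>down\<close> needs a positive index.\<close>
    then have "1 \<le> j \<longrightarrow> j \<in> J"
      by (induction rule: inc_induct) (use \<open>N \<in> J\<close> in \<open>auto intro: down\<close>)
    then show "j \<in> J"
      using j by simp
  qed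
  then have "card J = r \<longleftrightarrow> r \<in> J \<and> Suc r \<notin> J"
    using assms by auto
  then show ?thesis
    by (simp add: card J_def)
qed

section \<open>Independence of consecutive blocks of trials\<close>

lemma prob_trials_cong:
  assumes "\<And>xs. length xs = n \<Longrightarrow> xs \<in> A \<longleftrightarrow> xs \<in> B"
  shows "measure_pmf.prob (trials p n) A = measure_pmf.prob (trials p n) B"
  by (intro measure_pmf.finite_measure_eq_AE)
     (auto simp: AE_measure_pmf_iff trials_def set_replicate_pmf assms)

text \<open>The law of \<open>m + n\<close> trials is the image of a product law under
  concatenation.\<close>

lemma prob_trials_append:
  "measure_pmf.prob (trials p (m + n)) {xs. take m xs \<in> A \<and> drop m xs \<in> B} =
    measure_pmf.prob (trials p m) A * measure_pmf.prob (trials p n) B"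
proof -
  let ?P = "pair_pmf (trials p m) (trials p n)"
  have "trials p (m + n) = map_pmf (\<lambda>(xs, ys). xs @ ys) ?P"
    by (simp add: trials_def replicate_pmf_distrib pair_pmf_def map_pmf_def
        bind_assoc_pmf bind_return_pmf)
  then have "measure_pmf.prob (trials p (m + n)) {xs. take m xs \<in> A \<and> drop m xs \<in> B} =
      measure_pmf.prob ?P {(xs, ys). take m (xs @ ys) \<in> A \<and> drop m (xs @ ys) \<in> B}"
    by (simp add: vimage_def case_prod_unfold)
  also have "\<dots> = measure_pmf.prob ?P (A \<times> B)"
    by (intro measure_pmf.finite_measure_eq_AE)
       (auto simp: AE_measure_pmf_iff trials_def set_replicate_pmf)
  finally show ?thesis
    by (simp add: measure_pmf_prob_product)
qed

lemma prob_trials_failure: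
  assumes "0 \<le> p" "p \<le> 1"
  shows "measure_pmf.prob (trials p 1) {xs. \<not> xs ! 0} = 1 - p"
proof -
  have "(\<lambda>x. [x]) -` {xs. \<not> xs ! 0} = {False}" by auto
  then have "measure_pmf.prob (trials p 1) {xs. \<not> xs ! 0} =
      measure_pmf.prob (bernoulli_pmf p) {False}"
    unfolding trials_def replicate_pmf_1 measure_map_pmf by (simp only:)
  then show ?thesis
    using assms by (simp add: measure_pmf_single)
qed

text \<open>The shape of a renewal event: a past of \<open>m\<close> trials, the failure that ends
  the run, \<open>j\<close> free trials completing the gap, and a fresh future. With
  \<open>j = 0\<close> and \<open>B = UNIV\<close> it also handles events about the past and the
  failure alone.\<close>

lemma prob_trials_blocks:
  assumes "0 \<le> p" "p \<le> 1"
  shows "measure_pmf.prob (trials p (m + 1 + j + n))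
      {xs. take m xs \<in> A \<and> \<not> xs ! m \<and> drop (m + 1 + j) xs \<in> B} =
    measure_pmf.prob (trials p m) A * (1 - p) * measure_pmf.prob (trials p n) B"
proof -
  have "measure_pmf.prob (trials p (m + 1 + j + n))
      {xs. take m xs \<in> A \<and> \<not> xs ! m \<and> drop (m + 1 + j) xs \<in> B} =
    measure_pmf.prob (trials p (m + (1 + (j + n))))
      {xs. take m xs \<in> A \<and> drop m xs \<in>
        {ys. take 1 ys \<in> {xs. \<not> xs ! 0} \<and> drop 1 ys \<in>
          {zs. take j zs \<in> UNIV \<and> drop j zs \<in> B}}}"
    unfolding add.assoc by (intro prob_trials_cong) (simp add: add.commute)
  also have "\<dots> = measure_pmf.prob (trials p m) A *
      ((1 - p) * (1 * measure_pmf.prob (trials p n) B))"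
    unfolding prob_trials_append prob_trials_failure[OF assms] by simp
  finally show ?thesis by simp
qed

section \<open>Termination probabilities and the existence of the \<open>r\<close>-th run\<close>

lemma X_nonpos: "n \<le> 0 \<Longrightarrow> X p k g n r = 0"
  by (simp add: X_def)

lemma X_first: "X p k g n (Suc 0) = X p k g' n (Suc 0)"
  by (simp add: X_def success_run_1_iff)

text \<open>The run is decided by the first \<open>n\<close> trials and the failure is independent
  of them. The argument \<open>int n + 1\<close> is positive, so the zero convention does not
  interfere.\<close>

lemma X_Suc_eq:
  assumes "0 \<le> p" "p \<le> 1"
  shows "X p k g (int n + 1) r =
    measure_pmf.prob (trials p n) {xs. run_ends_at k g xs r n} * (1 - p)"
proof -
  have "X p k g (int n + 1) r =
      measure_pmf.prob (trials p (Suc n)) {xs. run_ends_at k g xs r n \<and> \<not> xs ! n}"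
    by (simp add: X_def run_ends_at_def nat_add_distrib)
  also have "\<dots> = measure_pmf.prob (trials p (n + 1 + 0 + 0))
      {xs. take n xs \<in> {xs. run_ends_at k g xs r n} \<and> \<not> xs ! n \<and> drop (n + 1 + 0) xs \<in> UNIV}"
    by (simp, intro prob_trials_cong) (auto simp: run_ends_at_take)
  finally show ?thesis
    unfolding prob_trials_blocks[OF assms] by simp
qed

text \<open>The failure demanded by \<open>X\<close> is automatic when a trial follows the run, and
  the trials after it are free.\<close>

lemma prob_run_ends_at_before:
  assumes "0 \<le> p" "p \<le> 1" "m < n"
  shows "measure_pmf.prob (trials p n) {xs. run_ends_at k g xs r m} = X p k g (int m + 1) r"
proof -
  have n: "m + 1 + 0 + (n - Suc m) = n"
    using assms by simp
  have "measure_pmf.prob (trials p n) {xs. run_ends_at k g xs r m} =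
    measure_pmf.prob (trials p (m + 1 + 0 + (n - Suc m)))
      {xs. take m xs \<in> {xs. run_ends_at k g xs r m} \<and> \<not> xs ! m \<and> drop (m + 1 + 0) xs \<in> UNIV}"
    unfolding n by (intro prob_trials_cong) (use assms in \<open>auto simp: run_ends_at_take\<close>)
  then show ?thesis
    unfolding prob_trials_blocks[OF assms(1,2)] X_Suc_eq[OF assms(1,2)] by simp
qed

text \<open>The \<open>r\<close>-th run ends at only one trial, so the events are disjoint. The sets
  \<open>A m\<close> leave room for a condition on what follows: none for existence, the next run
  for renewal.\<close>

lemma prob_UN_run_ends_at:
  "measure_pmf.prob (trials p n) (\<Union>m\<in>{..n}. {xs. run_ends_at k g xs r m} \<inter> A m) =
    (\<Sum>m\<le>n. measure_pmf.prob (trials p n) ({xs. run_ends_at k g xs r m} \<inter> A m))"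
  by (rule measure_pmf.finite_measure_finite_Union)
     (auto simp: disjoint_family_on_def dest: run_ends_at_unique)

lemma sum_int_reindex:
  fixes f :: "int \<Rightarrow> 'a :: comm_monoid_add"
  shows "(\<Sum>i\<in>{1..int n}. f i) = (\<Sum>m<n. f (int m + 1))"
  by (rule sum.reindex_bij_witness[of _ "\<lambda>m. int m + 1" "\<lambda>i. nat (i - 1)"]) auto

text \<open>
  For a run terminating at the last trial \<open>n\<close>, an appended failure turns it into the event of
  \<open>X\<close> at \<open>n + 1\<close>; this is the term divided by \<open>1 - p\<close>.
\<close>

lemma prob_run_exists:
  assumes "0 < p" "p < 1"
  shows "measure_pmf.prob (trials p n) {xs. \<exists>m. run_ends_at k g xs r m} =
    (\<Sum>i\<in>{1..int n}. X p k g i r) + X p k g (int n + 1) r / (1 - p)"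
proof -
  have "measure_pmf.prob (trials p n) {xs. \<exists>m. run_ends_at k g xs r m} =
      measure_pmf.prob (trials p n) (\<Union>m\<in>{..n}. {xs. run_ends_at k g xs r m} \<inter> UNIV)"
    by (intro prob_trials_cong) (auto dest: run_ends_at_bounds)
  also have "\<dots> = (\<Sum>m\<le>n. measure_pmf.prob (trials p n) {xs. run_ends_at k g xs r m})"
    unfolding prob_UN_run_ends_at by simp
  also have "\<dots> = (\<Sum>m<n. X p k g (int m + 1) r) +
      measure_pmf.prob (trials p n) {xs. run_ends_at k g xs r n}"
    using assms by (simp add: lessThan_Suc_atMost[symmetric] prob_run_ends_at_before)
  finally show ?thesis
    using assms by (simp add: sum_int_reindex X_Suc_eq)
qed

section \<open>The renewal equation and the removal of the gap\<close>

lemma X_renewal: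
  assumes "0 < p" "p < 1" "0 < r" "1 \<le> g"
  shows "X p k g n (Suc r) = (\<Sum>i\<in>{1..n}. X p k g i r * X p k 1 (n - i - (int g - 1)) 1)"
proof (cases "n \<le> 0")
  case True
  then show ?thesis by (simp add: X_nonpos)
next
  case False
  \<comment> \<open>Run \<open>Suc r\<close> ends at trial \<open>N\<close>, and trial
    \<open>n\<close> is the failure after it.\<close>
  define N where "N = nat (n - 1)"
  have n: "n = int N + 1"
    using False by (simp add: N_def)
  define B where "B m = {xs. m + g \<le> N \<and> run_ends_at k 1 (drop (m + g) xs) 1 (N - (m + g))}" for m
  \<comment> \<open>Here \<open>int m + 1\<close> is the trial of the failure after the
    \<open>r\<close>-th run. Its probability completes the first factor \<open>X\<close>; the
    explicit \<open>1 - p\<close>, from the failure at trial \<open>n\<close>, completes the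
    second.\<close>
  have summand: "measure_pmf.prob (trials p N) ({xs. run_ends_at k g xs r m} \<inter> B m) * (1 - p) =
      X p k g (int m + 1) r * X p k 1 (n - (int m + 1) - (int g - 1)) 1" for m
  proof (cases "m + g \<le> N")
    case True
    define l where "l = N - (m + g)"
    have N: "m + 1 + (g - 1) + l = N" and mg: "m + 1 + (g - 1) = m + g"
      using True assms by (auto simp: l_def)
    have "measure_pmf.prob (trials p N) ({xs. run_ends_at k g xs r m} \<inter> B m) =
      measure_pmf.prob (trials p (m + 1 + (g - 1) + l))
        {xs. take m xs \<in> {xs. run_ends_at k g xs r m} \<and> \<not> xs ! m \<and>
          drop (m + 1 + (g - 1)) xs \<in> {xs. run_ends_at k 1 xs 1 l}}"
      unfolding N unfolding mg
      by (intro prob_trials_cong)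
         (use True assms in \<open>auto simp: B_def l_def[symmetric] run_ends_at_take[of m]\<close>)
    moreover have "n - (int m + 1) - (int g - 1) = int l + 1"
      using True by (simp add: n l_def)
    ultimately show ?thesis
      using assms unfolding prob_trials_blocks[OF less_imp_le less_imp_le, OF assms(1,2)]
      by (simp add: X_Suc_eq)
  next
    case False
    then have "B m = {}" by (simp add: B_def)
    \<comment> \<open>If the gap does not fit before \<open>N\<close>, the argument of the second
      factor is nonpositive, so both sides vanish.\<close>
    moreover have "X p k 1 (n - (int m + 1) - (int g - 1)) 1 = 0"
      using False by (intro X_nonpos) (simp add: n)
    ultimately show ?thesis by simp
  qed
  have "measure_pmf.prob (trials p N) {xs. run_ends_at k g xs (Suc r) N} =
      measure_pmf.prob (trials p N) (\<Union>m\<in>{..N}. {xs. run_ends_at k g xs r m} \<inter> B m)"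
    using assms by (intro prob_trials_cong) (auto simp: run_ends_at_Suc_iff B_def)
  then have "X p k g n (Suc r) =
      (\<Sum>m\<le>N. measure_pmf.prob (trials p N) ({xs. run_ends_at k g xs r m} \<inter> B m) * (1 - p))"
    using assms unfolding n prob_UN_run_ends_at by (simp add: X_Suc_eq sum_distrib_right)
  also have "\<dots> = (\<Sum>m<Suc N. X p k g (int m + 1) r * X p k 1 (n - (int m + 1) - (int g - 1)) 1)"
    by (simp only: summand lessThan_Suc_atMost)
  also have "\<dots> = (\<Sum>i\<in>{1..int (Suc N)}. X p k g i r * X p k 1 (n - i - (int g - 1)) 1)"
    by (rule sum_int_reindex[symmetric])
  also have "int (Suc N) = n"
    by (simp add: n)
  finally show ?thesis .
qed

text \<open>The shift only adds summands at nonpositive arguments, where \<open>f\<close>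
  vanishes.\<close>

lemma sum_int_shift:
  fixes f :: "int \<Rightarrow> 'a :: comm_monoid_add"
  assumes "0 \<le> d" "\<And>i. i \<le> 0 \<Longrightarrow> f i = 0"
  shows "(\<Sum>i\<in>{1..n}. f (i - d)) = (\<Sum>i\<in>{1..n - d}. f i)"
proof -
  have "(\<Sum>i\<in>{1..n}. f (i - d)) = (\<Sum>i\<in>{1 - d..n - d}. f i)"
    by (rule sum.reindex_bij_witness[of _ "\<lambda>i. i + d" "\<lambda>i. i - d"]) auto
  also have "\<dots> = (\<Sum>i\<in>{1..n - d}. f i)"
    by (rule sum.mono_neutral_right) (use assms in auto)
  finally show ?thesis .
qed

lemma X_gap:
  assumes "0 < p" "p < 1" "1 \<le> g"
  shows "X p k g n (Suc r) = X p k 1 (n - int r * (int g - 1)) (Suc r)"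
proof (induction r arbitrary: n)
  case 0
  show ?case
    using X_first[of p k g n 1] by simp
next
  case (Suc r)
  define d where "d = int r * (int g - 1)"
  define e where "e = int g - 1"
  have nonneg: "0 \<le> d" "0 \<le> e"
    using assms by (simp_all add: d_def e_def)
  \<comment> \<open>The renewal summand after the induction hypothesis, with the index moved back by
    the accumulated delay \<open>d\<close>.\<close>
  define f where "f i = X p k 1 i (Suc r) * X p k 1 (n - d - i - e) 1" for i
  have f0: "f i = 0" if "i \<le> 0 \<or> n - d - e \<le> i" for i
    using that by (auto simp: f_def X_nonpos)
  have "X p k g n (Suc (Suc r)) = (\<Sum>i\<in>{1..n}. f (i - d))"
    using assms by (simp add: X_renewal Suc.IH f_def d_def e_def algebra_simps)
  also have "\<dots> = (\<Sum>i\<in>{1..n - d}. f i)"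
    by (rule sum_int_shift) (use nonneg f0 in auto)
  \<comment> \<open>For \<open>i\<close> beyond \<open>n - d - e\<close> the second factor has a
    nonpositive argument. The result is the convolution for gap 1, where renewal brings no
    delay.\<close>
  also have "\<dots> = (\<Sum>i\<in>{1..n - d - e}. f i)"
    by (rule sum.mono_neutral_right) (use nonneg f0 in auto)
  also have "\<dots> = X p k 1 (n - d - e) (Suc (Suc r))"
    using X_renewal[OF assms(1,2), of "Suc r" 1 k "n - d - e"] by (simp add: f_def algebra_simps)
  also have "n - d - e = n - int (Suc r) * (int g - 1)"
    by (simp add: d_def e_def algebra_simps)
  finally show ?case .
qed

section \<open>The distribution of the number of runs\<close>

lemma M_eq:
  assumes "0 < p" "p < 1" "1 \<le> r"
  shows "M p k g n r =
    ((\<Sum>i\<in>{1..n}. X p k g i r) + X p k g (n + 1) r / (1 - p)) -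
    ((\<Sum>i\<in>{1..n}. X p k g i (Suc r)) + X p k g (n + 1) (Suc r) / (1 - p))"
proof (cases "n \<le> 0")
  case True
  have "X p k g (n + 1) j = 0" for j
  proof (cases "n = 0")
    case True
    \<comment> \<open>For \<open>n = 0\<close> the argument of \<open>X\<close> is 1, outside the
      zero convention; the term vanishes because no run ends at trial 0.\<close>
    have "{xs. run_ends_at k g xs j 0} = {}"
      by (auto dest: run_ends_at_bounds)
    then show ?thesis
      using True X_Suc_eq[of p k g 0 j] assms by simp
  next
    case False
    then show ?thesis
      using \<open>n \<le> 0\<close> by (intro X_nonpos) simp
  qed
  then show ?thesis
    using True assms by (simp add: M_def)
next
  case False
  define R where "R j = {xs. \<exists>m. run_ends_at k g xs j m}" for j
  \<comment> \<open>Nested events turn the probability of exactly \<open>r\<close> runs into a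
    difference.\<close>
  have "R (Suc r) \<subseteq> R r"
    using assms by (auto simp: R_def run_ends_at_Suc_iff)
  moreover have "{xs. num_success_runs k g xs = r} = R r - R (Suc r)"
    using assms by (auto simp: R_def num_success_runs_eq_iff)
  ultimately have "M p k g n r =
      measure_pmf.prob (trials p (nat n)) (R r) - measure_pmf.prob (trials p (nat n)) (R (Suc r))"
    using False by (simp add: M_def measure_pmf.finite_measure_Diff)
  then show ?thesis
    using assms False by (simp add: R_def prob_run_exists)
qed

theorem theorem5p5:
  fixes k g r :: nat and n :: int and p q :: real
  assumes "k \<ge> 1" and "g \<ge> 1" and "n \<ge> 1" and "r \<ge> 1"
    and "0 < p" and "p < 1" and "q = 1 - p"
  shows "M p k g n r =
      1 / q * (X p k 1 (n + 1 - (int r - 1) * (int g - 1)) r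
               - X p k 1 (n + 1 - int r * (int g - 1)) r)
      + M p k 1 (n - int r * (int g - 1)) r
      + Y p k (n - (int r - 1) * (int g - 1)) r
      - Y p k (n - int r * (int g - 1)) r"
proof -
  have Y_eq: "(\<Sum>i\<in>{1..n}. X p k g i (Suc j)) = Y p k (n - int j * (int g - 1)) (Suc j)" for j
  proof -
    have "(\<Sum>i\<in>{1..n}. X p k g i (Suc j)) =
        (\<Sum>i\<in>{1..n}. X p k 1 (i - int j * (int g - 1)) (Suc j))"
      using assms by (intro sum.cong refl X_gap)
    also have "\<dots> = Y p k (n - int j * (int g - 1)) (Suc j)"
      unfolding Y_def by (rule sum_int_shift) (use assms in \<open>auto simp: X_nonpos\<close>)
    finally show ?thesis .
  qed
  obtain s where r: "r = Suc s"
    using assms by (cases r) auto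
  \<comment> \<open>\<open>N\<close> may be nonpositive; \<open>M_eq\<close> covers this case
    too.\<close>
  define N where "N = n - int r * (int g - 1)"
  have gap_s: "int s * (int g - 1) = (int r - 1) * (int g - 1)"
    by (simp add: r)
  \<comment> \<open>By \<open>X_gap\<close>, the terms for \<open>r\<close> are delayed by
    \<open>s\<close> extra gaps of length \<open>g - 1\<close> and those for \<open>Suc r\<close> by
    \<open>r\<close> of them.\<close>
  have "M p k g n r =
      (Y p k (n - int s * (int g - 1)) r + X p k 1 (n + 1 - int s * (int g - 1)) r / q) -
      (Y p k (n - int r * (int g - 1)) (Suc r) + X p k 1 (n + 1 - int r * (int g - 1)) (Suc r) / q)"
    using M_eq[OF assms(5,6,4), of k g n] Y_eq[of s] Y_eq[of r] X_gap[OF assms(5,6,2), of k "n + 1"] assms(7)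
    by (simp only: r)
  moreover have "M p k 1 N r = (Y p k N r + X p k 1 (N + 1) r / q) -
      (Y p k N (Suc r) + X p k 1 (N + 1) (Suc r) / q)"
    using M_eq[OF assms(5,6,4), of k 1 N] assms(7) by (simp add: Y_def)
  moreover have "N + 1 = n + 1 - int r * (int g - 1)"
    by (simp add: N_def)
  ultimately show ?thesis
    unfolding gap_s N_def[symmetric] by (simp add: diff_divide_distrib)
qed

end
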